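(* Let $\Sigma_{[\mathbb{O}]}\subset\mathbb{E}\mathrm{la}$ be the cubic stratum, i.e. the set of cubic elasticity tensors $\mathbf{E}=(\operatorname{tr}\mathbf{d},\operatorname{tr}\mathbf{v},0,0,\mathbf{H})$. A minimal functional basis for $\Sigma_{[\mathbb{O}]}$ (under the action of $\mathrm{SO}(3)$) consists of the three rational invariants $$\kappa_1:=\operatorname{tr}\mathbf{d},\qquad \kappa_2:=\operatorname{tr}\mathbf{v},\qquad \kappa_3:=\frac{I_3}{I_2}.$$
   Context: Tensors are on Euclidean $\mathbb{R}^3$, with components in an orthonormal basis $(e_i)$ and summation over repeated indices; $\mathbf{q}=(\delta_{ij})$ is the Euclidean metric. $\mathrm{SO}(3)$ acts on $n$th-order tensors by $(g\star \mathbf{T})_{i_1\dots i_n}=g_{i_1j_1}\cdots g_{i_nj_n}T_{j_1\dots j_n}$. $\mathbb{E}\mathrm{la}=\{\mathbf{E}\in\otimes^4(\mathbb{R}^3):E_{ijkl}=E_{klij}=E_{jikl}\}$ is the 21-dimensional space of elasticity tensors. $\mathbf{T}^s$ denotes the total symmetrization and $\mathbf{S}_1\odot\mathbf{S}_2:=(\mathbf{S}_1\otimes\mathbf{S}_2)^s$. For a symmetric second-order tensor, $\mathbf{a}'=\mathbf{a}-\frac13(\operatorname{tr}\mathbf{a})\mathbf{q}$. Harmonic decomposition: for $\mathbf{E}\in\mathbb{E}\mathrm{la}$, $d_{ij}=E_{kkij}$, $v_{ij}=E_{kikj}$, $\mathbf{a}=\frac27(\mathbf{d}+2\mathbf{v})$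 and $\mathbf{H}=\mathbf{E}^s-\mathbf{q}\odot\mathbf{a}'-\frac{7}{30}(\operatorname{tr}\mathbf{a})\,\mathbf{q}\odot\mathbf{q}$, which is a totally symmetric traceless fourth-order tensor. The tensor $\mathbf{E}$ is identified with the tuple $(\operatorname{tr}\mathbf{d},\operatorname{tr}\mathbf{v},\mathbf{d}',\mathbf{v}',\mathbf{H})$ (an $\mathrm{SO}(3)$-equivariant linear isomorphism); for a cubic tensor $\mathbf{d}'=\mathbf{v}'=0$. Invariants: $(\mathbf{d}_2)_{ij}=H_{ipqr}H_{pqrj}$, $(\mathbf{d}_3)_{ij}=H_{ikpq}H_{pqrs}H_{rskj}$, $I_2=\operatorname{tr}\mathbf{d}_2$, $I_3=\operatorname{tr}\mathbf{d}_3$. Stratum: for a subgroup $K$ of $\mathrm{SO}(3)$, $\Sigma_{[K]}$ is the set of tensors whose symmetry group $\{g\in\mathrm{SO}(3):g\star\mathbf{E}=\mathbf{E}\}$ is conjugate to $K$ in $\mathrm{SO}(3)$. $\mathbb{O}$ is the octahedral group: the 24 rotations preserving the cube with vertices $(\pm1,\pm1,\pm1)$. A tensor is cubic if it belongs to $\Sigma_{[\mathbb{O}]}$. Functional basis: a finite set $\{\varphi_1,\dots,\varphi_s\}$ of $\mathrm{SO}(3)$-invariant real functions on an $\mathrm{SO}(3)$-stable set $X$ is a functional basis for $X$ if for every $\mathrm{SO}(3)$-invariant function $f:X\to\mathbb{R}$ there is a function $F:\mathbb{R}^s\to\mathbb{R}$ (no regularity required) with $f(x)=F(\varphi_1(x),\dots,\varphi_s(x))$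 for all $x\in X$. It is minimal if no proper subset of it is a functional basis for $X$. *)

theory Defs
  imports "HOL-Analysis.Analysis"
begin

type_synonym tensor2 = "real^3^3"
type_synonym tensor4 = "real^3^3^3^3"

definition SO3 :: "(real^3^3) set" where
  "SO3 = {g. rotation_matrix g}"

definition rot :: "real^3^3 \<Rightarrow> tensor4 \<Rightarrow> tensor4" where
  "rot g T = (\<chi> i j k l. \<Sum>p\<in>UNIV. \<Sum>q\<in>UNIV. \<Sum>r\<in>UNIV. \<Sum>s\<in>UNIV.
     g$i$p * g$j$q * g$k$r * g$l$s * T$p$q$r$s)"

definition Ela :: "tensor4 set" where
  "Ela = {E. \<forall>i j k l. E$i$j$k$l = E$k$l$i$j \<and> E$i$j$k$l = E$j$i$k$l}"

subsection \<open>Symmetry classes\<close>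

definition symmetry_group :: "tensor4 \<Rightarrow> (real^3^3) set" where
  "symmetry_group E = {g \<in> SO3. rot g E = E}"

definition SO3_conjugate :: "(real^3^3) set \<Rightarrow> (real^3^3) set \<Rightarrow> bool" where
  "SO3_conjugate G K \<longleftrightarrow> (\<exists>g\<in>SO3. G = (\<lambda>k. g ** k ** matrix_inv g) ` K)"

definition stratum :: "(real^3^3) set \<Rightarrow> tensor4 set" where
  "stratum K = {E \<in> Ela. SO3_conjugate (symmetry_group E) K}"

definition cube :: "(real^3) set" where
  "cube = convex hull {v. \<forall>i. v$i \<in> {-1, 1}}"

definition octahedral_group :: "(real^3^3) set" where
  "octahedral_group = {g \<in> SO3. (\<lambda>v. g *v v) ` cube = cube}"

subsection \<open>Harmonic decomposition\<close>

definition tensor_product :: "tensor2 \<Rightarrow> tensor2 \<Rightarrow> tensor4" where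
  "tensor_product S1 S2 = (\<chi> i j k l. S1$i$j * S2$k$l)"

definition total_sym :: "tensor4 \<Rightarrow> tensor4" where
  "total_sym T = (\<chi> i j k l.
     (\<Sum>\<sigma> | \<sigma> permutes {..<4::nat}.
        let \<iota> = (\<lambda>n. [i, j, k, l] ! \<sigma> n) in T$(\<iota> 0)$(\<iota> 1)$(\<iota> 2)$(\<iota> 3)) / fact 4)"

definition sym_product :: "tensor2 \<Rightarrow> tensor2 \<Rightarrow> tensor4" where
  "sym_product S1 S2 = total_sym (tensor_product S1 S2)"

definition metric :: tensor2 where
  "metric = mat 1"

definition deviator :: "tensor2 \<Rightarrow> tensor2" where
  "deviator a = a - (1/3 * trace a) *\<^sub>R metric"

definition dilatation :: "tensor4 \<Rightarrow> tensor2" where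
  "dilatation E = (\<chi> i j. \<Sum>k\<in>UNIV. E$k$k$i$j)"

definition voigt :: "tensor4 \<Rightarrow> tensor2" where
  "voigt E = (\<chi> i j. \<Sum>k\<in>UNIV. E$k$i$k$j)"

definition harm_a :: "tensor4 \<Rightarrow> tensor2" where
  "harm_a E = (2/7) *\<^sub>R (dilatation E + 2 *\<^sub>R voigt E)"

definition harm_H :: "tensor4 \<Rightarrow> tensor4" where
  "harm_H E = total_sym E - sym_product metric (deviator (harm_a E))
     - (7/30 * trace (harm_a E)) *\<^sub>R sym_product metric metric"

subsection \<open>Invariants\<close>

definition d2 :: "tensor4 \<Rightarrow> tensor2" where
  "d2 H = (\<chi> i j. \<Sum>p\<in>UNIV. \<Sum>q\<in>UNIV. \<Sum>r\<in>UNIV. H$i$p$q$r * H$p$q$r$j)"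

definition d3 :: "tensor4 \<Rightarrow> tensor2" where
  "d3 H = (\<chi> i j. \<Sum>k\<in>UNIV. \<Sum>p\<in>UNIV. \<Sum>q\<in>UNIV. \<Sum>r\<in>UNIV. \<Sum>s\<in>UNIV.
     H$i$k$p$q * H$p$q$r$s * H$r$s$k$j)"

definition I2 :: "tensor4 \<Rightarrow> real" where
  "I2 E = trace (d2 (harm_H E))"

definition I3 :: "tensor4 \<Rightarrow> real" where
  "I3 E = trace (d3 (harm_H E))"

definition \<kappa>1 :: "tensor4 \<Rightarrow> real" where
  "\<kappa>1 E = trace (dilatation E)"

definition \<kappa>2 :: "tensor4 \<Rightarrow> real" where
  "\<kappa>2 E = trace (voigt E)"

definition \<kappa>3 :: "tensor4 \<Rightarrow> real" where
  "\<kappa>3 E = I3 E / I2 E"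

subsection \<open>Functional bases\<close>

definition SO3_stable :: "tensor4 set \<Rightarrow> bool" where
  "SO3_stable X \<longleftrightarrow> (\<forall>g\<in>SO3. \<forall>x\<in>X. rot g x \<in> X)"

definition SO3_invariant_on :: "tensor4 set \<Rightarrow> (tensor4 \<Rightarrow> real) \<Rightarrow> bool" where
  "SO3_invariant_on X f \<longleftrightarrow> (\<forall>g\<in>SO3. \<forall>x\<in>X. f (rot g x) = f x)"

text \<open>
  The coordinates of $\mathbf{R}^s$ are indexed by the $s$ elements of the set \<open>\<Phi>\<close> itself: the
  point $(\varphi_1(x),\dots,\varphi_s(x))$ is the family \<open>\<lambda>\<phi>\<in>\<Phi>. \<phi> x\<close>, undefined off \<open>\<Phi>\<close>.
  Functions on \<open>X\<close> are total functions of which only the values on \<open>X\<close> are used.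
\<close>

definition functional_basis :: "tensor4 set \<Rightarrow> (tensor4 \<Rightarrow> real) set \<Rightarrow> bool" where
  "functional_basis X \<Phi> \<longleftrightarrow>
     SO3_stable X \<and> finite \<Phi> \<and> (\<forall>\<phi>\<in>\<Phi>. SO3_invariant_on X \<phi>) \<and>
     (\<forall>f. SO3_invariant_on X f \<longrightarrow>
        (\<exists>F :: ((tensor4 \<Rightarrow> real) \<Rightarrow> real) \<Rightarrow> real. \<forall>x\<in>X. f x = F (\<lambda>\<phi>\<in>\<Phi>. \<phi> x)))"

definition minimal_functional_basis :: "tensor4 set \<Rightarrow> (tensor4 \<Rightarrow> real) set \<Rightarrow> bool" where
  "minimal_functional_basis X \<Phi> \<longleftrightarrow>
     functional_basis X \<Phi> \<and> (\<forall>\<Psi>. \<Psi> \<subset> \<Phi> \<longrightarrow> \<not> functional_basis X \<Psi>)"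

end

theory Submission
  imports Defs
begin

text \<open>
  Every cubic elasticity tensor has the normal form
  \<open>a (\<delta>\<^sub>i\<^sub>j \<delta>\<^sub>k\<^sub>l) + b (\<delta>\<^sub>i\<^sub>k \<delta>\<^sub>j\<^sub>l + \<delta>\<^sub>i\<^sub>l \<delta>\<^sub>j\<^sub>k) + t (\<Sum>m. h\<^sub>i\<^sub>m h\<^sub>j\<^sub>m h\<^sub>k\<^sub>m h\<^sub>l\<^sub>m)\<close>
  with \<open>h\<close> a rotation and \<open>t \<noteq> 0\<close>, and conversely (\<open>stratum_octahedral_eq\<close>). A rotation \<open>g\<close> merely
  replaces the frame \<open>h\<close> by \<open>g h\<close> (\<open>rot_cubic\<close>), so the orbits in the stratum are in bijection with the
  triples \<open>(a, b, t)\<close> with \<open>t \<noteq> 0\<close>.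

  That every cubic tensor has this form follows by imposing invariance under a few octahedral
  rotations (\<open>octahedral_fixed_imp_cubic\<close>). Conversely, an octahedral rotation is a signed permutation
  matrix (\<open>octahedral_group_iff\<close>), and for \<open>t \<noteq> 0\<close> these are the only rotations preserving the normal
  form in the standard frame (\<open>cubic_eq_iff\<close>).

  The harmonic part of a normal form is \<open>t\<close> times a fixed tensor rotated by \<open>h\<close>, which gives
  \<open>I\<^sub>2 = 6/5 t\<^sup>2\<close> and \<open>I\<^sub>3 = 6/25 t\<^sup>3\<close>. The three invariants are therefore
  \<open>\<kappa>\<^sub>1 = 9a + 6b + 3t\<close>, \<open>\<kappa>\<^sub>2 = 3a + 12b + 3t\<close> and \<open>\<kappa>\<^sub>3 = t/5\<close>, an invertible linear change of the parameters.
  So they separate the orbits, which is what a functional basis without regularity requires;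
  and since their values are independent of each other, none can be omitted.
\<close>

section \<open>Rotations\<close>

lemma SO3_orthogonal: "g \<in> SO3 \<Longrightarrow> orthogonal_matrix g"
  by (simp add: SO3_def rotation_matrix_def)

lemma SO3_id: "mat 1 \<in> SO3"
  by (simp add: SO3_def rotation_matrix_def orthogonal_matrix_id)

lemma SO3_mult: "g \<in> SO3 \<Longrightarrow> h \<in> SO3 \<Longrightarrow> g ** h \<in> SO3"
  by (simp add: SO3_def rotation_matrix_def orthogonal_matrix_mul det_mul)

lemma SO3_transpose: "g \<in> SO3 \<Longrightarrow> transpose g \<in> SO3"
  by (simp add: SO3_def rotation_matrix_def)

lemma orthogonal_cancel:
  fixes g :: "real^'n^'n"
  assumes "orthogonal_matrix g"
  shows "g ** transpose g = mat 1" "transpose g ** g = mat 1"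
  using assms by (auto simp: orthogonal_matrix_def)

lemma matrix_inv_orthogonal:
  fixes g :: "real^'n^'n"
  assumes "orthogonal_matrix g"
  shows "matrix_inv g = transpose g"
proof -
  have "g ** matrix_inv g = mat 1 \<and> matrix_inv g ** g = mat 1"
    unfolding matrix_inv_def by (rule someI[of _ "transpose g"]) (simp add: orthogonal_cancel assms)
  then have "transpose g ** (g ** matrix_inv g) = transpose g" by simp
  then show ?thesis by (simp only: matrix_mul_assoc orthogonal_cancel[OF assms] matrix_mul_lid)
qed

lemma orthogonal_rows:
  assumes "orthogonal_matrix h"
  shows "(\<Sum>m\<in>UNIV. h$i$m * h$j$m) = metric$i$j"
proof -
  have "(h ** transpose h)$i$j = metric$i$j"
    using assms by (simp add: orthogonal_matrix_def metric_def)
  then show ?thesis by (simp add: matrix_matrix_mult_def transpose_def)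
qed

lemma orthogonal_columns:
  assumes "orthogonal_matrix h"
  shows "(\<Sum>i\<in>UNIV. h$i$m * h$i$n) = metric$m$n"
proof -
  have "orthogonal_matrix (transpose h)" using assms by simp
  from orthogonal_rows[OF this, of m n] show ?thesis by (simp add: transpose_def)
qed

section \<open>Cubic normal forms\<close>

text \<open>
  The tensor \<open>a \<otimes> b \<otimes> c \<otimes> d\<close>. Rotations act on each factor separately, so writing a tensor as a
  combination of such terms makes its image under a rotation visible.
\<close>

definition simple_tensor :: "real^3 \<Rightarrow> real^3 \<Rightarrow> real^3 \<Rightarrow> real^3 \<Rightarrow> tensor4" where
  "simple_tensor a b c d = (\<chi> i j k l. a$i * b$j * c$k * d$l)"

lemma sum_product4:
  fixes A B C D :: "'a::finite \<Rightarrow> real"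
  shows "(\<Sum>p\<in>UNIV. \<Sum>q\<in>UNIV. \<Sum>r\<in>UNIV. \<Sum>s\<in>UNIV. A p * (B q * (C r * D s)))
    = (\<Sum>p\<in>UNIV. A p) * ((\<Sum>q\<in>UNIV. B q) * ((\<Sum>r\<in>UNIV. C r) * (\<Sum>s\<in>UNIV. D s)))"
  unfolding sum_product unfolding sum_distrib_left ..

lemma rot_simple_tensor: "rot g (simple_tensor a b c d) = simple_tensor (g *v a) (g *v b) (g *v c) (g *v d)"
proof -
  have "rot g (simple_tensor a b c d) $i$j$k$l = simple_tensor (g *v a) (g *v b) (g *v c) (g *v d) $i$j$k$l" for i j k l
    using sum_product4[of "\<lambda>p. g$i$p * a$p" "\<lambda>p. g$j$p * b$p" "\<lambda>p. g$k$p * c$p" "\<lambda>p. g$l$p * d$p"]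
    by (simp add: rot_def simple_tensor_def matrix_vector_mult_def mult_ac)
  then show ?thesis by (simp add: vec_eq_iff)
qed

lemma rot_add: "rot g (A + B) = rot g A + rot g B"
  by (simp add: rot_def vec_eq_iff sum.distrib algebra_simps)

lemma rot_scaleR: "rot g (c *\<^sub>R A) = c *\<^sub>R rot g A"
  by (simp add: rot_def vec_eq_iff sum_distrib_left mult_ac)

lemma rot_sum: "finite S \<Longrightarrow> rot g (\<Sum>x\<in>S. f x) = (\<Sum>x\<in>S. rot g (f x))"
proof (induction S rule: finite_induct)
  case empty show ?case by (simp add: rot_def vec_eq_iff)
next
  case (insert x S) then show ?case by (simp add: rot_add)
qed

text \<open>
  The normal form of a cubic tensor, for orthogonal \<open>h\<close>. The columns \<open>h\<^sub>m\<close> of \<open>h\<close> are the axes of the cube, \<open>a\<close> and \<open>b\<close>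
  are the Lame constants of the isotropic part, and \<open>t\<close> measures the departure from isotropy:
  it is the coefficient of the sum of the fourth tensor powers of the \<open>h\<^sub>m\<close>.
\<close>

definition cubic :: "real \<Rightarrow> real \<Rightarrow> real \<Rightarrow> real^3^3 \<Rightarrow> tensor4" where
  "cubic a b t h = (\<chi> i j k l. a * (metric$i$j * metric$k$l)
     + b * (metric$i$k * metric$j$l + metric$i$l * metric$j$k)
     + t * (\<Sum>m\<in>UNIV. h$i$m * h$j$m * h$k$m * h$l$m))"

lemma cubic_nth: "cubic a b t h $i$j$k$l = a * (metric$i$j * metric$k$l)
     + b * (metric$i$k * metric$j$l + metric$i$l * metric$j$k)
     + t * (\<Sum>m\<in>UNIV. h$i$m * h$j$m * h$k$m * h$l$m)"
  by (simp add: cubic_def)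

text \<open>
  The orthogonality of \<open>h\<close> enters through \<open>\<delta>\<^sub>i\<^sub>j = (\<Sum>m. h\<^sub>i\<^sub>m h\<^sub>j\<^sub>m)\<close>, which expresses
  the isotropic part in the frame \<open>h\<close> as well.
\<close>

lemma cubic_eq_sum_simple_tensor:
  assumes "orthogonal_matrix h"
  shows "cubic a b t h =
    a *\<^sub>R (\<Sum>m\<in>UNIV. \<Sum>n\<in>UNIV. simple_tensor (column m h) (column m h) (column n h) (column n h))
    + b *\<^sub>R (\<Sum>m\<in>UNIV. \<Sum>n\<in>UNIV. simple_tensor (column m h) (column n h) (column m h) (column n h))
    + b *\<^sub>R (\<Sum>m\<in>UNIV. \<Sum>n\<in>UNIV. simple_tensor (column m h) (column n h) (column n h) (column m h))
    + t *\<^sub>R (\<Sum>m\<in>UNIV. simple_tensor (column m h) (column m h) (column m h) (column m h))"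
  unfolding vec_eq_iff
  by (simp add: cubic_nth orthogonal_rows[OF assms, symmetric] simple_tensor_def column_def sum_product
      algebra_simps)

lemma column_mult: "column m (g ** h) = g *v column m h"
  by (simp add: vec_eq_iff column_def matrix_matrix_mult_def matrix_vector_mult_def)

lemma rot_cubic:
  assumes "orthogonal_matrix g" "orthogonal_matrix h"
  shows "rot g (cubic a b t h) = cubic a b t (g ** h)"
  unfolding cubic_eq_sum_simple_tensor[OF assms(2)] cubic_eq_sum_simple_tensor[OF orthogonal_matrix_mul[OF assms]]
  by (simp add: rot_add rot_scaleR rot_sum rot_simple_tensor column_mult)

section \<open>Fourth-order tensors as endomorphisms of second-order tensors\<close>

text \<open>
  A fourth-order tensor read as a 9 by 9 matrix, whose rows are indexed by the first two
  indices of the tensor and whose columns by the last two.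
\<close>

definition flat :: "tensor4 \<Rightarrow> real^(3\<times>3)^(3\<times>3)" where
  "flat T = (\<chi> x y. T $ fst x $ snd x $ fst y $ snd y)"

text \<open>
  The Kronecker square of a matrix: the action on second-order tensors, in the same indexing.
\<close>

definition kron :: "real^3^3 \<Rightarrow> real^(3\<times>3)^(3\<times>3)" where
  "kron g = (\<chi> x y. g $ fst x $ fst y * g $ snd x $ snd y)"

lemma sum_prod_UNIV: "(\<Sum>x\<in>UNIV. f x) = (\<Sum>i\<in>UNIV. \<Sum>j\<in>UNIV. f (i, j))"
  by (simp add: sum.cartesian_product)

lemma flat_inject: "flat S = flat T \<longleftrightarrow> S = T"
  by (auto simp: flat_def vec_eq_iff)

text \<open>
  In this reading the rotation of tensors becomes conjugation of matrices.
\<close>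

lemma flat_rot: "flat (rot g T) = kron g ** flat T ** transpose (kron g)"
proof -
  have "(\<Sum>p\<in>UNIV. \<Sum>q\<in>UNIV. \<Sum>r\<in>UNIV. \<Sum>s\<in>UNIV. g$i$p * g$j$q * g$k$r * g$l$s * T$p$q$r$s)
    = (\<Sum>y\<in>UNIV. (\<Sum>x\<in>UNIV. kron g $ (i,j) $ x * flat T $ x $ y) * kron g $ (k,l) $ y)"
    (is "?lhs i j k l = ?rhs i j k l") for i j k l
  proof -
    have "?lhs i j k l = (\<Sum>x\<in>UNIV. \<Sum>y\<in>UNIV. kron g $ (i,j) $ x * flat T $ x $ y * kron g $ (k,l) $ y)"
      unfolding sum_prod_UNIV kron_def flat_def by (simp add: mult_ac)
    also have "\<dots> = ?rhs i j k l"
      by (subst sum.swap) (simp add: sum_distrib_right)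
    finally show ?thesis .
  qed
  then show ?thesis
    by (simp add: vec_eq_iff matrix_matrix_mult_def transpose_def flat_def rot_def)
qed

lemma kron_mult: "kron (g ** h) = kron g ** kron h"
  by (simp add: vec_eq_iff kron_def matrix_matrix_mult_def sum_prod_UNIV sum_product mult_ac)

lemma kron_transpose: "kron (transpose g) = transpose (kron g)"
  by (simp add: vec_eq_iff kron_def transpose_def)

lemma kron_id: "kron (mat 1) = mat 1"
  by (auto simp add: vec_eq_iff kron_def mat_def)

lemma rot_mult: "rot g (rot h T) = rot (g ** h) T"
  unfolding flat_inject[symmetric] flat_rot kron_mult matrix_transpose_mul
  by (simp add: matrix_mul_assoc)

lemma rot_id: "rot (mat 1) T = T"
  unfolding flat_inject[symmetric] flat_rot kron_id by simp

section \<open>Harmonic part and invariants of the normal forms\<close>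

text \<open>
  The 24 permutations of the four indices, grouped by the first index.
\<close>

lemma total_sym_expand: "total_sym T $i$j$k$l =
  (T$i$j$k$l + T$i$j$l$k + T$i$k$j$l + T$i$k$l$j + T$i$l$j$k + T$i$l$k$j
 + T$j$i$k$l + T$j$i$l$k + T$j$k$i$l + T$j$k$l$i + T$j$l$i$k + T$j$l$k$i
 + T$k$i$j$l + T$k$i$l$j + T$k$j$i$l + T$k$j$l$i + T$k$l$i$j + T$k$l$j$i
 + T$l$i$j$k + T$l$i$k$j + T$l$j$i$k + T$l$j$k$i + T$l$k$i$j + T$l$k$j$i) / 24"
proof -
  have "{..<4::nat} = insert 0 (insert 1 (insert 2 (insert 3 {})))" by auto
  then show ?thesis
    by (simp add: total_sym_def sum_over_permutations_insert permutes_sing Let_def fact_numeral transpose_def)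
qed

lemma metric_sym: "metric$i$j = metric$j$i"
  by (simp add: metric_def mat_def)

lemma trace_metric: "trace metric = 3"
  by (simp add: metric_def trace_I)

lemma sum_metric_delta: "(\<Sum>k\<in>UNIV. metric$k$i * f k) = f i" "(\<Sum>k\<in>UNIV. metric$i$k * f k) = f i"
  by (simp_all add: metric_def mat_def if_distrib[of "\<lambda>x. x * _"] cong: if_cong)

lemma sum_metric_diagonal: "(\<Sum>k\<in>UNIV. metric$k$k) = 3"
  using trace_metric by (simp add: trace_def)

lemma frame_contract:
  assumes "orthogonal_matrix h"
  shows "(\<Sum>k\<in>UNIV. \<Sum>m\<in>UNIV. h$k$m * h$k$m * h$i$m * h$j$m) = metric$i$j"
proof -
  have "(\<Sum>k\<in>UNIV. \<Sum>m\<in>UNIV. h$k$m * h$k$m * h$i$m * h$j$m)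
      = (\<Sum>m\<in>UNIV. (\<Sum>k\<in>UNIV. h$k$m * h$k$m) * (h$i$m * h$j$m))"
    by (subst sum.swap) (simp add: sum_distrib_left mult_ac)
  also have "\<dots> = metric$i$j"
    by (simp add: orthogonal_columns[OF assms]) (simp add: metric_def mat_def orthogonal_rows[OF assms])
  finally show ?thesis .
qed

lemma dilatation_cubic:
  assumes "orthogonal_matrix h"
  shows "dilatation (cubic a b t h) = (3 * a + 2 * b + t) *\<^sub>R metric"
proof -
  have "dilatation (cubic a b t h) $i$j = ((3 * a + 2 * b + t) *\<^sub>R metric) $i$j" for i j
    using frame_contract[OF assms, of i j]
    by (simp add: dilatation_def cubic_nth sum.distrib sum_distrib_left[symmetric] sum_distrib_right[symmetric]
       sum_metric_delta metric_sym sum_metric_diagonal algebra_simps)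
  then show ?thesis by (simp add: vec_eq_iff)
qed

lemma voigt_cubic:
  assumes "orthogonal_matrix h"
  shows "voigt (cubic a b t h) = (a + 4 * b + t) *\<^sub>R metric"
proof -
  have "voigt (cubic a b t h) $i$j = ((a + 4 * b + t) *\<^sub>R metric) $i$j" for i j
  proof -
    have "(\<Sum>k\<in>UNIV. \<Sum>m\<in>UNIV. h$k$m * h$i$m * h$k$m * h$j$m) = metric$i$j"
      using frame_contract[OF assms, of i j] by (simp add: mult_ac)
    then show ?thesis
      by (simp add: voigt_def cubic_nth sum.distrib sum_distrib_left[symmetric] sum_distrib_right[symmetric]
       sum_metric_delta metric_sym[of i j] sum_metric_diagonal algebra_simps)
  qed
  then show ?thesis by (simp add: vec_eq_iff)
qed

lemma trace_scaleR: "trace (c *\<^sub>R (A::real^'n^'n)) = c * trace A"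
  by (simp add: trace_def sum_distrib_left)

lemma \<kappa>1_cubic: "orthogonal_matrix h \<Longrightarrow> \<kappa>1 (cubic a b t h) = 9 * a + 6 * b + 3 * t"
  by (simp add: \<kappa>1_def dilatation_cubic trace_scaleR trace_metric)

lemma \<kappa>2_cubic: "orthogonal_matrix h \<Longrightarrow> \<kappa>2 (cubic a b t h) = 3 * a + 12 * b + 3 * t"
  by (simp add: \<kappa>2_def voigt_cubic trace_scaleR trace_metric)

lemma total_sym_cubic: "total_sym (cubic a b t h) = cubic ((a + 2 * b) / 3) ((a + 2 * b) / 3) t h"
proof -
  have "total_sym (cubic a b t h) $i$j$k$l = cubic ((a + 2 * b) / 3) ((a + 2 * b) / 3) t h $i$j$k$l" for i j k l
    unfolding total_sym_expand cubic_nth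
    by (simp add: metric_sym mult_ac add_divide_distrib[symmetric]) (simp add: algebra_simps)
  then show ?thesis by (simp add: vec_eq_iff)
qed

lemma tensor_product_metric: "tensor_product metric metric = cubic 1 0 0 h"
  by (simp add: tensor_product_def cubic_def)

text \<open>
  The harmonic part carries the parameter \<open>t\<close> only, and it is again a normal form. The coefficient
  \<open>-1/5\<close> is the one that makes it traceless.
\<close>

lemma harm_H_cubic:
  assumes "orthogonal_matrix h"
  shows "harm_H (cubic a b t h) = t *\<^sub>R cubic (-1/5) (-1/5) 1 h"
proof -
  have a: "harm_a (cubic a b t h) = (2/7 * (5 * a + 10 * b + 3 * t)) *\<^sub>R metric"
    by (simp add: harm_a_def dilatation_cubic voigt_cubic assms scaleR_add_left[symmetric])
  have dev: "deviator (harm_a (cubic a b t h)) = 0"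
    by (simp add: a deviator_def trace_scaleR trace_metric)
  have tr: "trace (harm_a (cubic a b t h)) = 6/7 * (5 * a + 10 * b + 3 * t)"
    by (simp add: a trace_scaleR trace_metric)
  have zero: "sym_product metric 0 = 0"
    by (simp add: vec_eq_iff sym_product_def tensor_product_def total_sym_expand)
  have qq: "sym_product metric metric = cubic (1/3) (1/3) 0 h"
    by (simp add: sym_product_def tensor_product_metric[of h] total_sym_cubic)
  show ?thesis
    unfolding harm_H_def dev tr zero qq total_sym_cubic vec_eq_iff
    by (simp add: cubic_nth field_simps)
qed

text \<open>
  For tensors with enough index symmetry the two invariants are power traces of the flattened
  tensor, hence unchanged under conjugation.
\<close>

lemma trace_d2_eq:
  assumes "\<And>i j k l. T$i$j$k$l = T$j$k$l$i"
  shows "trace (d2 T) = trace (flat T ** flat T)"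
  unfolding trace_def d2_def matrix_matrix_mult_def flat_def sum_prod_UNIV
  by simp (intro sum.cong refl arg_cong[where f = "(*) _"] assms)

lemma trace_d3_eq:
  assumes "\<And>i j k l. T$i$j$k$l = T$i$j$l$k"
  shows "trace (d3 T) = trace (flat T ** flat T ** flat T)"
proof -
  have "trace (d3 T) = (\<Sum>x\<in>UNIV. \<Sum>y\<in>UNIV. \<Sum>z\<in>UNIV. flat T $ x $ y * flat T $ y $ z * flat T $ z $ x)"
    unfolding trace_def d3_def flat_def sum_prod_UNIV
    by simp (intro sum.cong refl arg_cong[where f = "(*) _"] assms)
  also have "\<dots> = (\<Sum>x\<in>UNIV. \<Sum>z\<in>UNIV. \<Sum>y\<in>UNIV. flat T $ x $ y * flat T $ y $ z * flat T $ z $ x)"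
    by (subst (2) sum.swap) (rule refl)
  also have "\<dots> = trace (flat T ** flat T ** flat T)"
    by (simp add: trace_def matrix_matrix_mult_def sum_distrib_right)
  finally show ?thesis .
qed

lemma kron_orthogonal:
  assumes "orthogonal_matrix g"
  shows "transpose (kron g) ** kron g = mat 1"
  by (simp add: kron_transpose[symmetric] kron_mult[symmetric] orthogonal_cancel[OF assms] kron_id)

lemma trace_conjugate:
  fixes K :: "real^'n^'n"
  assumes "transpose K ** K = mat 1"
  shows "trace (K ** A ** transpose K) = trace A"
  by (metis assms matrix_mul_assoc matrix_mul_lid trace_mul_sym)

lemma trace_flat_rot:
  assumes "orthogonal_matrix g"
  shows "trace (flat (rot g T) ** flat (rot g T)) = trace (flat T ** flat T)"
    and "trace (flat (rot g T) ** flat (rot g T) ** flat (rot g T)) = trace (flat T ** flat T ** flat T)"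
proof -
  let ?K = "kron g" and ?F = "flat T"
  have K: "transpose ?K ** ?K = mat 1" by (rule kron_orthogonal[OF assms])
  then have K': "transpose ?K ** (?K ** X) = X" for X :: "real^(3\<times>3)^(3\<times>3)"
    by (simp add: matrix_mul_assoc)
  have "flat (rot g T) ** flat (rot g T) = ?K ** (?F ** ?F) ** transpose ?K"
    unfolding flat_rot by (simp add: matrix_mul_assoc[symmetric] K')
  then show "trace (flat (rot g T) ** flat (rot g T)) = trace (flat T ** flat T)"
    by (simp add: trace_conjugate K)
  have "flat (rot g T) ** flat (rot g T) ** flat (rot g T) = ?K ** (?F ** ?F ** ?F) ** transpose ?K"
    unfolding flat_rot by (simp add: matrix_mul_assoc[symmetric] K')
  then show "trace (flat (rot g T) ** flat (rot g T) ** flat (rot g T)) = trace (?F ** ?F ** ?F)"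
    by (simp add: trace_conjugate K)
qed

text \<open>
  The 9 by 9 matrix has eigenvalues \<open>3/5\<close> (twice), \<open>-2/5\<close> (three times) and 0 (four times).
\<close>

lemma trace_harmonic_cubic:
  fixes F defines "F \<equiv> flat (cubic (-1/5) (-1/5) 1 (mat 1))"
  shows "trace (F ** F) = 6/5" and "trace (F ** F ** F) = 6/25"
proof -
  show "trace (F ** F) = 6/5"
    by (simp add: F_def trace_def matrix_matrix_mult_def flat_def sum_prod_UNIV cubic_nth metric_def mat_def sum_3)
  show "trace (F ** F ** F) = 6/25"
    by (simp add: F_def trace_def matrix_matrix_mult_def flat_def sum_prod_UNIV cubic_nth metric_def mat_def sum_3)
qed

lemma d2_scaleR: "d2 (c *\<^sub>R T) = c^2 *\<^sub>R d2 T"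
  by (simp add: d2_def vec_eq_iff sum_distrib_left power2_eq_square mult_ac)

lemma d3_scaleR: "d3 (c *\<^sub>R T) = c^3 *\<^sub>R d3 T"
  by (simp add: d3_def vec_eq_iff sum_distrib_left power3_eq_cube mult_ac)

lemma
  assumes h: "orthogonal_matrix h"
  shows I2_cubic: "I2 (cubic a b t h) = 6/5 * t^2"
    and I3_cubic: "I3 (cubic a b t h) = 6/25 * t^3"
proof -
  let ?T = "cubic (-1/5) (-1/5) 1 h" and ?T1 = "cubic (-1/5) (-1/5) 1 (mat 1)"
  have rot: "?T = rot h ?T1" by (simp add: rot_cubic h orthogonal_matrix_id)
  have cyc: "?T$i$j$k$l = ?T$j$k$l$i" and swap: "?T$i$j$k$l = ?T$i$j$l$k" for i j k l
    by (simp_all add: cubic_nth metric_sym mult_ac add_divide_distrib)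
  show "I2 (cubic a b t h) = 6/5 * t^2"
    unfolding I2_def harm_H_cubic[OF h] d2_scaleR trace_scaleR trace_d2_eq[OF cyc]
    unfolding rot trace_flat_rot[OF h] trace_harmonic_cubic by simp
  show "I3 (cubic a b t h) = 6/25 * t^3"
    unfolding I3_def harm_H_cubic[OF h] d3_scaleR trace_scaleR trace_d3_eq[OF swap]
    unfolding rot trace_flat_rot[OF h] trace_harmonic_cubic by simp
qed

lemma \<kappa>3_cubic: "orthogonal_matrix h \<Longrightarrow> \<kappa>3 (cubic a b t h) = t / 5"
  by (simp add: \<kappa>3_def I2_cubic I3_cubic power2_eq_square power3_eq_cube)

section \<open>The octahedral group\<close>

lemma inner_orthogonal_self:
  fixes g :: "real^'n^'n"
  assumes "orthogonal_matrix g"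
  shows "(g *v v) \<bullet> (g *v v) = v \<bullet> v"
  by (metis assms dot_lmul_matrix matrix_vector_mul_assoc matrix_vector_mul_lid
      orthogonal_cancel(2) vector_transpose_matrix transpose_matrix_vector)

text \<open>
  The octahedral group consists of the rotations with at most one nonzero entry in each row,
  that is, of the signed permutation matrices of determinant 1.
\<close>

lemma octahedral_group_iff:
  "g \<in> octahedral_group \<longleftrightarrow> g \<in> SO3 \<and> (\<forall>i m n. m \<noteq> n \<longrightarrow> g$i$m * g$i$n = 0)"
proof (intro iffI conjI allI impI)
  assume g: "g \<in> octahedral_group"
  then show "g \<in> SO3" by (simp add: octahedral_group_def)
  then have orth: "orthogonal_matrix g" by (rule SO3_orthogonal)
  have cube_le: "cube \<subseteq> {v. \<forall>i. \<bar>v$i\<bar> \<le> 1}"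
    unfolding cube_def
  proof (rule hull_minimal)
    have "{v::real^3. \<forall>i. \<bar>v$i\<bar> \<le> 1} = cbox (\<chi> i. -1) (\<chi> i. 1)"
      by (auto simp: mem_box_cart abs_le_iff minus_le_iff)
    then show "convex {v::real^3. \<forall>i. \<bar>v$i\<bar> \<le> 1}" by simp
    show "{v::real^3. \<forall>i. v$i \<in> {-1, 1}} \<subseteq> {v. \<forall>i. \<bar>v$i\<bar> \<le> 1}"
    proof clarify
      fix v :: "real^3" and i assume "\<forall>i. v$i \<in> {-1, 1}"
      then have "v$i = -1 \<or> v$i = 1" by blast
      then show "\<bar>v$i\<bar> \<le> 1" by auto
    qed
  qed
  \<comment> \<open>The vertices are the points of the cube with squared norm 3, and \<open>g\<close> preserves both conditions.\<close>
  have vertex: "((g *v v)$i)\<^sup>2 = 1" if v: "\<forall>i. v$i \<in> {-1, 1}" for v i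
  proof -
    have "v \<in> cube" unfolding cube_def using v by (intro hull_inc) simp
    then have "g *v v \<in> cube" using g by (auto simp: octahedral_group_def)
    then have "\<bar>(g *v v)$j\<bar> \<le> 1" for j using cube_le by auto
    then have le: "((g *v v)$j)\<^sup>2 \<le> 1" for j by (simp add: abs_square_le_1)
    have "(v$j)\<^sup>2 = 1" for j using v by (metis insertE one_power2 power2_minus singletonD)
    then have "v \<bullet> v = 3" by (simp add: inner_vec_def sum_3 power2_eq_square)
    then have "((g *v v)$1)\<^sup>2 + ((g *v v)$2)\<^sup>2 + ((g *v v)$3)\<^sup>2 = 3"
      using inner_orthogonal_self[OF orth, of v] by (simp add: inner_vec_def sum_3 power2_eq_square)
    then show ?thesis using le[of 1] le[of 2] le[of 3] exhaust_3[of i] by auto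
  qed
  fix i m n :: 3
  assume "m \<noteq> n"
  have sq: "(g$i$1 * a + g$i$2 * b + g$i$3 * c)\<^sup>2 = 1" if "a \<in> {-1,1}" "b \<in> {-1,1}" "c \<in> {-1,1}" for a b c
    using vertex[of "vector [a,b,c]" i] that
    by (simp add: forall_3 matrix_vector_mult_def sum_3)
  have q: "(g$i$1 + g$i$2 + g$i$3)\<^sup>2 = 1" "(g$i$1 + g$i$2 - g$i$3)\<^sup>2 = 1"
     "(g$i$1 - g$i$2 + g$i$3)\<^sup>2 = 1" "(g$i$1 - g$i$2 - g$i$3)\<^sup>2 = 1"
    using sq[of 1 1 1] sq[of 1 1 "-1"] sq[of 1 "-1" 1] sq[of 1 "-1" "-1"] by simp_all
  let ?x = "g$i$1" and ?y = "g$i$2" and ?z = "g$i$3"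
  \<comment> \<open>Polarization: a quadratic form constant on all sign vectors has no mixed terms.\<close>
  have "8 * (?x * ?y) = (?x + ?y + ?z)\<^sup>2 + (?x + ?y - ?z)\<^sup>2 - (?x - ?y + ?z)\<^sup>2 - (?x - ?y - ?z)\<^sup>2"
    "8 * (?x * ?z) = (?x + ?y + ?z)\<^sup>2 - (?x + ?y - ?z)\<^sup>2 + (?x - ?y + ?z)\<^sup>2 - (?x - ?y - ?z)\<^sup>2"
    "8 * (?y * ?z) = (?x + ?y + ?z)\<^sup>2 - (?x + ?y - ?z)\<^sup>2 - (?x - ?y + ?z)\<^sup>2 + (?x - ?y - ?z)\<^sup>2"
    by (simp_all add: power2_eq_square algebra_simps)
  then have "?x * ?y = 0" "?x * ?z = 0" "?y * ?z = 0"
    unfolding q by simp_all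
  then show "g$i$m * g$i$n = 0"
    using exhaust_3[of m] exhaust_3[of n] \<open>m \<noteq> n\<close> by (auto simp: mult.commute)
next
  let ?V = "{v::real^3. \<forall>i. v$i \<in> {-1, 1}}"
  assume g: "g \<in> SO3 \<and> (\<forall>i m n. m \<noteq> n \<longrightarrow> g$i$m * g$i$n = 0)"
  then have orth: "orthogonal_matrix g" by (simp add: SO3_orthogonal)
  have "(g *v v)$i \<in> {-1, 1}" if v: "\<forall>i. v$i \<in> {-1, 1}" for v i
  proof -
    have v2: "(v$j)\<^sup>2 = 1" for j using v by (metis insertE one_power2 power2_minus singletonD)
    have z: "g$i$1 * g$i$2 = 0" "g$i$1 * g$i$3 = 0" "g$i$2 * g$i$3 = 0" using g by simp_all
    have "((g *v v)$i)\<^sup>2 = (g$i$1)\<^sup>2 * (v$1)\<^sup>2 + (g$i$2)\<^sup>2 * (v$2)\<^sup>2 + (g$i$3)\<^sup>2 * (v$3)\<^sup>2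
       + 2 * (g$i$1 * g$i$2) * (v$1 * v$2) + 2 * (g$i$1 * g$i$3) * (v$1 * v$3) + 2 * (g$i$2 * g$i$3) * (v$2 * v$3)"
      by (simp add: matrix_vector_mult_def sum_3 power2_eq_square algebra_simps)
    also have "\<dots> = (\<Sum>m\<in>UNIV. g$i$m * g$i$m)" by (simp add: z v2 sum_3) (simp add: power2_eq_square)
    also have "\<dots> = 1"
      unfolding orthogonal_rows[OF orth] by (simp add: metric_def mat_def)
    finally show ?thesis by (auto simp: power2_eq_1_iff)
  qed
  then have sub: "(\<lambda>v. g *v v) ` ?V \<subseteq> ?V" by blast
  have "inj (\<lambda>v. g *v v)"
    by (rule inj_on_inverseI[of _ "\<lambda>v. transpose g *v v"])
      (simp add: matrix_vector_mul_assoc orthogonal_cancel[OF orth])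
  \<comment> \<open>An injection of the finite set of vertices into itself is onto.\<close>
  moreover have "finite ?V"
  proof (rule finite_subset)
    show "?V \<subseteq> (\<lambda>(a,b,c). vector [a,b,c]) ` ({-1,1} \<times> {-1,1} \<times> {-1,1})"
    proof
      fix v assume "v \<in> ?V"
      then have v: "v$i \<in> {-1, 1}" for i by blast
      then have "(v$1, v$2, v$3) \<in> {-1,1} \<times> {-1,1} \<times> {-1,1}" by (intro SigmaI v)
      moreover have "v = (\<lambda>(a,b,c). vector [a,b,c]) (v$1, v$2, v$3)"
        by (simp add: vec_eq_iff forall_3)
      ultimately show "v \<in> (\<lambda>(a,b,c). vector [a,b,c]) ` ({-1,1} \<times> {-1,1} \<times> {-1,1})"
        by (rule rev_image_eqI)
    qed
  qed simp
  ultimately have "(\<lambda>v. g *v v) ` ?V = ?V"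
    using sub by (meson endo_inj_surj inj_on_subset subset_UNIV)
  then have "(\<lambda>v. g *v v) ` cube = cube"
    unfolding cube_def by (simp only: convex_hull_linear_image[OF matrix_vector_mul_linear])
  then show "g \<in> octahedral_group" using g by (simp add: octahedral_group_def)
qed

section \<open>The cubic stratum\<close>

lemma cubic_in_Ela: "cubic a b t h \<in> Ela"
  by (auto simp: Ela_def cubic_nth metric_sym mult_ac)

lemma rot_Ela:
  assumes "E \<in> Ela"
  shows "rot g E \<in> Ela"
proof -
  have maj: "E$i$j$k$l = E$k$l$i$j" and min: "E$i$j$k$l = E$j$i$k$l" for i j k l
    using assms by (auto simp: Ela_def)
  have "transpose (flat E) = flat E"
    unfolding vec_eq_iff by (simp add: flat_def transpose_def) (rule allI maj)+
  then have "transpose (flat (rot g E)) = flat (rot g E)"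
    by (simp add: flat_rot matrix_transpose_mul matrix_mul_assoc)
  then have "transpose (flat (rot g E)) $ (i, j) $ (k, l) = flat (rot g E) $ (i, j) $ (k, l)" for i j k l
    by simp
  then have "rot g E $i$j$k$l = rot g E $k$l$i$j" for i j k l
    by (simp add: transpose_def flat_def)
  moreover have "rot g E $i$j$k$l = rot g E $j$i$k$l" for i j k l
  proof -
    have "rot g E $i$j$k$l = (\<Sum>q\<in>UNIV. \<Sum>p\<in>UNIV. \<Sum>r\<in>UNIV. \<Sum>s\<in>UNIV.
        g$i$p * g$j$q * g$k$r * g$l$s * E$p$q$r$s)"
      unfolding rot_def by simp (rule sum.swap)
    also have "\<dots> = rot g E $j$i$k$l"
      unfolding rot_def by (simp add: mult_ac) (intro sum.cong refl arg_cong2[where f = "(*)"] min)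
    finally show ?thesis .
  qed
  ultimately show ?thesis unfolding Ela_def by blast
qed

text \<open>
  An octahedral rotation permutes the coordinate axes up to sign, and so it preserves the sum
  of their fourth tensor powers. The right-hand side is 1 if all four indices agree, else 0.
\<close>

lemma quartic_frame_octahedral:
  assumes "g \<in> octahedral_group"
  shows "(\<Sum>m\<in>UNIV. g$i$m * g$j$m * g$k$m * g$l$m) = metric$i$j * metric$k$l * metric$i$k"
proof -
  have orth: "orthogonal_matrix g" and mono: "\<And>i m n. m \<noteq> n \<Longrightarrow> g$i$m * g$i$n = 0"
    using assms by (auto simp: octahedral_group_iff SO3_orthogonal)
  \<comment> \<open>Multiply the orthogonality of rows \<open>i\<close> and \<open>j\<close> by \<open>g\<^sub>i\<^sub>m\<close>: only the term with index \<open>m\<close> survives.\<close>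
  have red: "g$i$m * g$i$m * g$j$m = metric$i$j * g$i$m" for i j m
  proof -
    have "metric$i$j * g$i$m = (\<Sum>n\<in>UNIV. (g$i$m * g$i$n) * g$j$n)"
      unfolding orthogonal_rows[OF orth, symmetric] by (simp add: sum_distrib_left mult_ac)
    also have "\<dots> = (\<Sum>n\<in>UNIV. if n = m then (g$i$m * g$i$m) * g$j$m else 0)"
      using mono by (intro sum.cong) auto
    also have "\<dots> = g$i$m * g$i$m * g$j$m" by simp
    finally show ?thesis by (rule sym)
  qed
  have pair: "g$i$m * g$j$m = metric$i$j * (g$i$m * g$i$m)" for i j m
    using red[of i m j] by (cases "i = j") (auto simp: metric_def mat_def)
  have "g$i$m * g$j$m * g$k$m * g$l$m = metric$i$j * metric$k$l * metric$i$k * (g$i$m * g$i$m)" for m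
  proof -
    have "g$i$m * g$j$m * g$k$m * g$l$m = (g$i$m * g$j$m) * (g$k$m * g$l$m)" by (simp add: mult_ac)
    also have "\<dots> = metric$i$j * metric$k$l * ((g$i$m * g$k$m) * (g$i$m * g$k$m))"
      by (simp add: pair[of i m j] pair[of k m l] mult_ac)
    also have "(g$i$m * g$k$m) * (g$i$m * g$k$m) = metric$i$k * (g$i$m * g$i$m)"
      using red[of i m i] by (cases "i = k") (auto simp: metric_def mat_def pair[of i m k])
    finally show ?thesis by (simp add: mult_ac)
  qed
  then have "(\<Sum>m\<in>UNIV. g$i$m * g$j$m * g$k$m * g$l$m)
      = metric$i$j * metric$k$l * metric$i$k * (\<Sum>m\<in>UNIV. g$i$m * g$i$m)"
    unfolding sum_distrib_left by (intro sum.cong refl)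
  then show ?thesis
    unfolding orthogonal_rows[OF orth] by (simp add: metric_def mat_def)
qed

lemma octahedral_id: "mat 1 \<in> octahedral_group"
  by (simp add: octahedral_group_iff SO3_id) (simp add: mat_def)

text \<open>
  For \<open>t \<noteq> 0\<close> the symmetry group of the normal form in the standard frame is exactly the
  octahedral group.
\<close>

lemma cubic_eq_iff:
  assumes "g \<in> SO3" "t \<noteq> 0"
  shows "cubic a b t g = cubic a b t (mat 1) \<longleftrightarrow> g \<in> octahedral_group"
proof
  assume "g \<in> octahedral_group"
  then show "cubic a b t g = cubic a b t (mat 1)"
    by (simp only: vec_eq_iff cubic_nth quartic_frame_octahedral octahedral_id simp_thms)
next
  assume eq: "cubic a b t g = cubic a b t (mat 1)"
  have orth: "orthogonal_matrix g" using assms by (simp add: SO3_orthogonal)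
  have "g$i$m * g$i$n = 0" if "m \<noteq> n" for i m n
  proof -
    have "cubic a b t g $i$i$i$i = cubic a b t (mat 1) $i$i$i$i" by (simp add: eq)
    then have "(\<Sum>m\<in>UNIV. g$i$m * g$i$m * g$i$m * g$i$m) = 1"
      using \<open>t \<noteq> 0\<close> unfolding cubic_nth quartic_frame_octahedral[OF octahedral_id]
      by (simp add: metric_def mat_def)
    \<comment> \<open>The squared entries of row \<open>i\<close> and the squares of these both sum to 1, so the mixed products vanish.\<close>
    moreover have "(\<Sum>m\<in>UNIV. g$i$m * g$i$m)\<^sup>2 = 1"
      unfolding orthogonal_rows[OF orth] by (simp add: metric_def mat_def)
    ultimately have "(g$i$1 * g$i$2)\<^sup>2 + (g$i$1 * g$i$3)\<^sup>2 + (g$i$2 * g$i$3)\<^sup>2 = 0"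
      by (simp add: sum_3 power2_eq_square algebra_simps)
    then have "g$i$1 * g$i$2 = 0" "g$i$1 * g$i$3 = 0" "g$i$2 * g$i$3 = 0"
      by (simp_all only: power2_eq_square[symmetric] add_nonneg_eq_0_iff zero_le_power2 add_nonneg_nonneg zero_eq_power2 power_eq_0_iff)
    then show ?thesis
      using exhaust_3[of m] exhaust_3[of n] \<open>m \<noteq> n\<close> by (auto simp: mult.commute)
  qed
  then show "g \<in> octahedral_group" using assms by (simp add: octahedral_group_iff)
qed

text \<open>
  The matrix sending the axis \<open>e\<^bsub>\<sigma> i\<^esub>\<close> to \<open>s i\<close> times \<open>e\<^sub>i\<close>, for a bijection \<open>\<sigma>\<close> of the axes.
\<close>

definition signed_perm :: "(3 \<Rightarrow> real) \<Rightarrow> (3 \<Rightarrow> 3) \<Rightarrow> real^3^3" where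
  "signed_perm s \<sigma> = (\<chi> i j. if j = \<sigma> i then s i else 0)"

lemma rot_signed_perm:
  "rot (signed_perm s \<sigma>) E $i$j$k$l = s i * s j * s k * s l * E $ \<sigma> i $ \<sigma> j $ \<sigma> k $ \<sigma> l"
  by (simp add: rot_def signed_perm_def if_distrib[of "\<lambda>x. x * _"] if_distrib[of "\<lambda>x. _ * x"]
      cong: if_cong)

lemma signed_perm_octahedral:
  assumes "\<And>i. s i * s i = 1" "inj \<sigma>" "det (signed_perm s \<sigma>) = 1"
  shows "signed_perm s \<sigma> \<in> octahedral_group"
proof -
  have "signed_perm s \<sigma> ** transpose (signed_perm s \<sigma>) = mat 1"
    using assms(1,2)
    by (simp add: vec_eq_iff matrix_matrix_mult_def transpose_def signed_perm_def mat_def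
       if_distrib[of "\<lambda>x. x * _"] inj_eq cong: if_cong)
  moreover from this have "transpose (signed_perm s \<sigma>) ** signed_perm s \<sigma> = mat 1"
    by (rule matrix_left_right_inverse[THEN iffD1])
  ultimately have "signed_perm s \<sigma> \<in> SO3"
    using assms(3) by (simp add: SO3_def rotation_matrix_def orthogonal_matrix_def)
  then show ?thesis
    by (simp add: octahedral_group_iff) (simp add: signed_perm_def)
qed

text \<open>
  Half-turns about two coordinate axes kill every component in which some index occurs an odd
  number of times. The cyclic permutation of the axes, with the index symmetries of elasticity
  tensors, then leaves the three constants \<open>E\<^sub>1\<^sub>1\<^sub>1\<^sub>1\<close>, \<open>E\<^sub>1\<^sub>1\<^sub>2\<^sub>2\<close> and \<open>E\<^sub>1\<^sub>2\<^sub>1\<^sub>2\<close>.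
\<close>

lemma octahedral_fixed_imp_cubic:
  assumes E: "E \<in> Ela" and fixed: "\<And>g. g \<in> octahedral_group \<Longrightarrow> rot g E = E"
  obtains a b t where "E = cubic a b t (mat 1)"
proof -
  have maj: "E$i$j$k$l = E$k$l$i$j" and min: "E$i$j$k$l = E$j$i$k$l" for i j k l
    using E by (auto simp: Ela_def)
  define s1 s3 :: "3 \<Rightarrow> real" where "s1 = (\<lambda>i. if i = 1 then 1 else -1)"
    and "s3 = (\<lambda>i. if i = 3 then 1 else -1)"
  define \<sigma> :: "3 \<Rightarrow> 3" where "\<sigma> = (\<lambda>i. if i = 1 then 2 else if i = 2 then 3 else 1)"
  have "signed_perm s1 id \<in> octahedral_group" "signed_perm s3 id \<in> octahedral_group"
    by (rule signed_perm_octahedral; simp add: det_3 signed_perm_def s1_def s3_def)+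
  then have "rot (signed_perm s1 id) E = E" "rot (signed_perm s3 id) E = E"
    by (simp_all add: fixed)
  then have "E$i$j$k$l = s1 i * s1 j * s1 k * s1 l * E$i$j$k$l"
    "E$i$j$k$l = s3 i * s3 j * s3 k * s3 l * E$i$j$k$l" for i j k l
    using rot_signed_perm[of s1 id E i j k l] rot_signed_perm[of s3 id E i j k l] by simp_all
  then have zero: "E$i$j$k$l = 0"
    if "s1 i * s1 j * s1 k * s1 l = -1 \<or> s3 i * s3 j * s3 k * s3 l = -1" for i j k l
    using that by (metis add.inverse_inverse mult_minus1 neg_equal_zero)
  have "inj \<sigma>"
  proof (rule injI)
    fix i j :: 3 assume "\<sigma> i = \<sigma> j"
    then show "i = j" using exhaust_3[of i] exhaust_3[of j] by (auto simp: \<sigma>_def)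
  qed
  then have "signed_perm (\<lambda>_. 1) \<sigma> \<in> octahedral_group"
    by (intro signed_perm_octahedral) (simp_all add: det_3 signed_perm_def \<sigma>_def)
  then have cyc: "E $ \<sigma> i $ \<sigma> j $ \<sigma> k $ \<sigma> l = E$i$j$k$l" for i j k l
    using rot_signed_perm[of "\<lambda>_. 1" \<sigma> E i j k l] fixed by simp
  have eqs: "E$2$2$2$2 = E$1$1$1$1" "E$3$3$3$3 = E$1$1$1$1"
    "E$2$2$3$3 = E$1$1$2$2" "E$3$3$1$1 = E$1$1$2$2"
    "E$2$3$2$3 = E$1$2$1$2" "E$3$1$3$1 = E$1$2$1$2"
    using cyc[of 1 1 1 1] cyc[of 2 2 2 2] cyc[of 1 1 2 2] cyc[of 2 2 3 3] cyc[of 1 2 1 2] cyc[of 2 3 2 3]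
    by (simp_all add: \<sigma>_def)
  have eqs': "E$2$2$1$1 = E$1$1$2$2" "E$3$3$2$2 = E$1$1$2$2" "E$1$1$3$3 = E$1$1$2$2"
    "E$2$1$1$2 = E$1$2$1$2" "E$1$2$2$1 = E$1$2$1$2" "E$2$1$2$1 = E$1$2$1$2"
    "E$3$2$2$3 = E$1$2$1$2" "E$2$3$3$2 = E$1$2$1$2" "E$3$2$3$2 = E$1$2$1$2"
    "E$3$1$1$3 = E$1$2$1$2" "E$1$3$3$1 = E$1$2$1$2" "E$1$3$1$3 = E$1$2$1$2"
    by (metis maj min eqs)+
  have "E = cubic (E$1$1$2$2) (E$1$2$1$2) (E$1$1$1$1 - E$1$1$2$2 - 2 * E$1$2$1$2) (mat 1)"
    unfolding vec_eq_iff cubic_nth quartic_frame_octahedral[OF octahedral_id]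
    unfolding forall_3 metric_def mat_def
    by (simp add: eqs eqs' zero s1_def s3_def)
  then show ?thesis by (rule that)
qed

text \<open>
  Hence isotropic tensors, which all rotations fix, are not in the cubic stratum.
\<close>

lemma not_octahedral_rotation:
  obtains r where "r \<in> SO3" "r \<notin> octahedral_group"
proof
  let ?r = "vector [vector [3/5, -4/5, 0], vector [4/5, 3/5, 0], vector [0, 0, 1]] :: real^3^3"
  show "?r \<in> SO3"
    by (simp add: SO3_def rotation_matrix_def orthogonal_matrix det_3 vec_eq_iff forall_3
       matrix_matrix_mult_def transpose_def sum_3 mat_def)
  have "?r$1$1 * ?r$1$2 \<noteq> 0" by simp
  moreover have "(1::3) \<noteq> 2" by simp
  ultimately show "?r \<notin> octahedral_group" unfolding octahedral_group_iff by blast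
qed

lemma stratum_octahedral_eq:
  "stratum octahedral_group = {cubic a b t h | a b t h. t \<noteq> 0 \<and> h \<in> SO3}"
proof (intro subset_antisym subsetI)
  fix E assume "E \<in> stratum octahedral_group"
  then obtain g where E: "E \<in> Ela" and g: "g \<in> SO3"
    and sym: "symmetry_group E = (\<lambda>k. g ** k ** transpose g) ` octahedral_group"
    unfolding stratum_def SO3_conjugate_def by (auto simp: matrix_inv_orthogonal SO3_orthogonal)
  have og: "orthogonal_matrix g" by (rule SO3_orthogonal[OF g])
  have fixed: "rot k (rot (transpose g) E) = rot (transpose g) E" if "k \<in> octahedral_group" for k
  proof -
    have "g ** k ** transpose g \<in> symmetry_group E" using sym that by blast
    then have "rot (transpose g) (rot (g ** k ** transpose g) E) = rot (transpose g) E"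
      by (simp add: symmetry_group_def)
    then show ?thesis
      by (simp add: rot_mult matrix_mul_assoc orthogonal_cancel[OF og])
  qed
  from octahedral_fixed_imp_cubic[OF rot_Ela[OF E] fixed]
  obtain a b t where "rot (transpose g) E = cubic a b t (mat 1)" .
  then have "rot g (rot (transpose g) E) = cubic a b t g"
    by (simp add: rot_cubic og orthogonal_matrix_id)
  then have Ec: "E = cubic a b t g" by (simp add: rot_mult orthogonal_cancel[OF og] rot_id)
  \<comment> \<open>If \<open>t = 0\<close>, every rotation fixes \<open>E\<close>, in particular a conjugate of one that is not octahedral.\<close>
  have "t \<noteq> 0"
  proof
    assume "t = 0"
    obtain r where r: "r \<in> SO3" "r \<notin> octahedral_group" by (rule not_octahedral_rotation)
    have "g ** r ** transpose g \<in> symmetry_group E"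
      using r g by (simp add: symmetry_group_def SO3_mult SO3_transpose Ec rot_cubic SO3_orthogonal)
        (simp add: cubic_def \<open>t = 0\<close>)
    then obtain k where k: "k \<in> octahedral_group" "g ** r ** transpose g = g ** k ** transpose g"
      using sym by auto
    then have "transpose g ** (g ** r ** transpose g) ** g = transpose g ** (g ** k ** transpose g) ** g" by simp
    then have "r = k"
      by (simp add: matrix_mul_assoc orthogonal_cancel[OF og])
        (simp add: matrix_mul_assoc[symmetric] orthogonal_cancel[OF og])
    with r k show False by simp
  qed
  then show "E \<in> {cubic a b t h | a b t h. t \<noteq> 0 \<and> h \<in> SO3}" using Ec g by blast
next
  fix E assume "E \<in> {cubic a b t h | a b t h. t \<noteq> 0 \<and> h \<in> SO3}"
  then obtain a b t h where Ec: "E = cubic a b t h" and t: "t \<noteq> 0" and h: "h \<in> SO3" by blast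
  have oh: "orthogonal_matrix h" by (rule SO3_orthogonal[OF h])
  have conj: "h ** (transpose h ** k ** h) ** transpose h = k" "transpose h ** (h ** k ** transpose h) ** h = k" for k
    by (simp add: matrix_mul_assoc orthogonal_cancel[OF oh],
        simp add: matrix_mul_assoc[symmetric] orthogonal_cancel[OF oh])+
  have fix_iff: "rot k E = E \<longleftrightarrow> transpose h ** k ** h \<in> octahedral_group" if k: "k \<in> SO3" for k
  proof -
    have "rot k E = E \<longleftrightarrow> rot (transpose h) (rot k E) = rot (transpose h) E"
      by (metis rot_mult orthogonal_cancel(1)[OF oh] rot_id)
    also have "\<dots> \<longleftrightarrow> cubic a b t (transpose h ** k ** h) = cubic a b t (mat 1)"
      by (simp add: Ec rot_mult rot_cubic SO3_orthogonal SO3_mult SO3_transpose k h orthogonal_cancel[OF oh]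
        matrix_mul_assoc)
    also have "\<dots> \<longleftrightarrow> transpose h ** k ** h \<in> octahedral_group"
      by (rule cubic_eq_iff) (simp_all add: SO3_mult SO3_transpose k h t)
    finally show ?thesis .
  qed
  have "symmetry_group E = (\<lambda>k. h ** k ** matrix_inv h) ` octahedral_group"
    unfolding matrix_inv_orthogonal[OF oh]
  proof (intro subset_antisym subsetI)
    fix k assume "k \<in> symmetry_group E"
    then have "transpose h ** k ** h \<in> octahedral_group"
      using fix_iff[of k] by (simp add: symmetry_group_def)
    then show "k \<in> (\<lambda>k. h ** k ** transpose h) ` octahedral_group"
      by (rule rev_image_eqI) (simp add: conj)
  next
    fix k assume "k \<in> (\<lambda>k. h ** k ** transpose h) ` octahedral_group"
    then obtain m where m: "m \<in> octahedral_group" "k = h ** m ** transpose h" by blast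
    then have "k \<in> SO3" using h by (simp add: SO3_mult SO3_transpose octahedral_group_def)
    then show "k \<in> symmetry_group E" using m by (simp add: symmetry_group_def fix_iff conj)
  qed
  then show "E \<in> stratum octahedral_group"
    unfolding stratum_def SO3_conjugate_def using h by (auto simp: Ec cubic_in_Ela)
qed

section \<open>The functional basis\<close>

text \<open>
  All values with \<open>\<kappa>\<^sub>3 \<noteq> 0\<close> occur; this independence gives minimality. The witness solves the linear
  system \<open>9a + 6b + 3t = x\<close>, \<open>3a + 12b + 3t = y\<close>, \<open>t/5 = z\<close>.
\<close>

lemma cubic_with_invariants:
  assumes "z \<noteq> 0"
  obtains E where "E \<in> stratum octahedral_group" "\<kappa>1 E = x" "\<kappa>2 E = y" "\<kappa>3 E = z"
proof
  let ?E = "cubic ((4 * x - 2 * y) / 30 - z) ((3 * y - x) / 30 - z) (5 * z) (mat 1)"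
  show "?E \<in> stratum octahedral_group"
  proof -
    have "5 * z \<noteq> 0" using assms by simp
    then show ?thesis using SO3_id unfolding stratum_octahedral_eq by blast
  qed
  show "\<kappa>1 ?E = x" "\<kappa>2 ?E = y" "\<kappa>3 ?E = z"
    by (simp_all add: \<kappa>1_cubic \<kappa>2_cubic \<kappa>3_cubic orthogonal_matrix_id field_simps)
qed

lemma invariants_separate_orbits:
  assumes "E \<in> stratum octahedral_group" "E' \<in> stratum octahedral_group"
    and "\<kappa>1 E = \<kappa>1 E'" "\<kappa>2 E = \<kappa>2 E'" "\<kappa>3 E = \<kappa>3 E'"
  obtains g where "g \<in> SO3" "E' = rot g E"
proof -
  obtain a b t h a' b' t' h' where E: "E = cubic a b t h" "h \<in> SO3" and E': "E' = cubic a' b' t' h'" "h' \<in> SO3"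
    using assms(1,2) unfolding stratum_octahedral_eq by blast
  then have "9 * a + 6 * b + 3 * t = 9 * a' + 6 * b' + 3 * t'"
    "3 * a + 12 * b + 3 * t = 3 * a' + 12 * b' + 3 * t'" "t = t'"
    using assms(3-5) by (simp_all add: \<kappa>1_cubic \<kappa>2_cubic \<kappa>3_cubic SO3_orthogonal)
  then have "a = a'" "b = b'" "t = t'" by linarith+
  then have "E' = rot (h' ** transpose h) E"
    using E E' by (simp add: rot_cubic SO3_orthogonal SO3_mult SO3_transpose)
      (simp add: matrix_mul_assoc[symmetric] orthogonal_cancel SO3_orthogonal)
  moreover have "h' ** transpose h \<in> SO3" using E E' by (simp add: SO3_mult SO3_transpose)
  ultimately show ?thesis using that by blast
qed

lemma stratum_stable: "SO3_stable (stratum octahedral_group)"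
  unfolding SO3_stable_def stratum_octahedral_eq
  by (clarsimp simp: rot_cubic SO3_orthogonal) (metis SO3_mult)

lemma invariants_invariant:
  "\<phi> \<in> {\<kappa>1, \<kappa>2, \<kappa>3} \<Longrightarrow> SO3_invariant_on (stratum octahedral_group) \<phi>"
  unfolding SO3_invariant_on_def stratum_octahedral_eq
  by (auto simp: rot_cubic \<kappa>1_cubic \<kappa>2_cubic \<kappa>3_cubic SO3_orthogonal SO3_mult)

text \<open>
  Since the function \<open>F\<close> need not be regular, separating orbits is enough: \<open>F\<close> evaluates the given
  invariant at a chosen point of the fibre.
\<close>

lemma separating_imp_functional_basis:
  assumes "SO3_stable X" "finite \<Phi>" "\<And>\<phi>. \<phi> \<in> \<Phi> \<Longrightarrow> SO3_invariant_on X \<phi>"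
    and sep: "\<And>x y. x \<in> X \<Longrightarrow> y \<in> X \<Longrightarrow> (\<And>\<phi>. \<phi> \<in> \<Phi> \<Longrightarrow> \<phi> x = \<phi> y) \<Longrightarrow> \<exists>g\<in>SO3. y = rot g x"
  shows "functional_basis X \<Phi>"
  unfolding functional_basis_def
proof (intro conjI allI impI)
  fix f assume f: "SO3_invariant_on X f"
  let ?F = "\<lambda>p. f (SOME x. x \<in> X \<and> (\<lambda>\<phi>\<in>\<Phi>. \<phi> x) = p)"
  have "f x = ?F (\<lambda>\<phi>\<in>\<Phi>. \<phi> x)" if x: "x \<in> X" for x
  proof -
    let ?y = "SOME y. y \<in> X \<and> (\<lambda>\<phi>\<in>\<Phi>. \<phi> y) = (\<lambda>\<phi>\<in>\<Phi>. \<phi> x)"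
    have y: "?y \<in> X \<and> (\<lambda>\<phi>\<in>\<Phi>. \<phi> ?y) = (\<lambda>\<phi>\<in>\<Phi>. \<phi> x)" by (rule someI[of _ x]) (simp add: x)
    have "\<phi> x = \<phi> ?y" if "\<phi> \<in> \<Phi>" for \<phi>
      using fun_cong[OF conjunct2[OF y], of \<phi>] that by simp
    with sep[OF x conjunct1[OF y]] obtain g where "g \<in> SO3" "?y = rot g x" by blast
    then have "f ?y = f x" using f x by (simp add: SO3_invariant_on_def)
    then show ?thesis by simp
  qed
  then show "\<exists>F. \<forall>x\<in>X. f x = F (\<lambda>\<phi>\<in>\<Phi>. \<phi> x)" by (intro exI[of _ ?F]) blast
qed (use assms in auto)

lemma functional_basis_determines:
  assumes "functional_basis X \<Psi>" "SO3_invariant_on X f" "x \<in> X" "y \<in> X" "\<And>\<phi>. \<phi> \<in> \<Psi> \<Longrightarrow> \<phi> x = \<phi> y"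
  shows "f x = f y"
proof -
  obtain F where "\<And>x. x \<in> X \<Longrightarrow> f x = F (\<lambda>\<phi>\<in>\<Psi>. \<phi> x)"
    using assms(1,2) unfolding functional_basis_def by blast
  moreover have "(\<lambda>\<phi>\<in>\<Psi>. \<phi> x) = (\<lambda>\<phi>\<in>\<Psi>. \<phi> y)" using assms(5) by (intro restrict_ext) auto
  ultimately show ?thesis using assms(3,4) by metis
qed

theorem theorem6p1:
  shows "(\<forall>E \<in> stratum octahedral_group. I2 E \<noteq> 0) \<and>
    card {\<kappa>1, \<kappa>2, \<kappa>3} = 3 \<and>
    minimal_functional_basis (stratum octahedral_group) {\<kappa>1, \<kappa>2, \<kappa>3}"
proof (intro conjI ballI)
  let ?X = "stratum octahedral_group"
  show "I2 E \<noteq> 0" if "E \<in> ?X" for E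
    using that unfolding stratum_octahedral_eq by (auto simp: I2_cubic SO3_orthogonal)
  \<comment> \<open>\<open>E1\<close>, \<open>E2\<close>, \<open>E3\<close> each differ from \<open>E0\<close> in exactly one of the three invariants.\<close>
  obtain E0 where E0: "E0 \<in> ?X" "\<kappa>1 E0 = 0" "\<kappa>2 E0 = 0" "\<kappa>3 E0 = 1"
    by (rule cubic_with_invariants[of 1 0 0]) simp_all
  obtain E1 where E1: "E1 \<in> ?X" "\<kappa>1 E1 = 1" "\<kappa>2 E1 = 0" "\<kappa>3 E1 = 1"
    by (rule cubic_with_invariants[of 1 1 0]) simp_all
  obtain E2 where E2: "E2 \<in> ?X" "\<kappa>1 E2 = 0" "\<kappa>2 E2 = 1" "\<kappa>3 E2 = 1"
    by (rule cubic_with_invariants[of 1 0 1]) simp_all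
  obtain E3 where E3: "E3 \<in> ?X" "\<kappa>1 E3 = 0" "\<kappa>2 E3 = 0" "\<kappa>3 E3 = 2"
    by (rule cubic_with_invariants[of 2 0 0]) simp_all
  have "\<kappa>1 \<noteq> \<kappa>2" "\<kappa>1 \<noteq> \<kappa>3" "\<kappa>2 \<noteq> \<kappa>3" using E0 E1 by auto
  then show "card {\<kappa>1, \<kappa>2, \<kappa>3} = 3" by simp
  show "minimal_functional_basis ?X {\<kappa>1, \<kappa>2, \<kappa>3}"
    unfolding minimal_functional_basis_def
  proof (intro conjI allI impI notI)
    show "functional_basis ?X {\<kappa>1, \<kappa>2, \<kappa>3}"
    proof (rule separating_imp_functional_basis)
      fix x y assume xy: "x \<in> ?X" "y \<in> ?X"
        and eq: "\<And>\<phi>. \<phi> \<in> {\<kappa>1, \<kappa>2, \<kappa>3} \<Longrightarrow> \<phi> x = \<phi> y"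
      have "\<kappa>1 x = \<kappa>1 y" "\<kappa>2 x = \<kappa>2 y" "\<kappa>3 x = \<kappa>3 y"
        by (rule eq, simp)+
      from invariants_separate_orbits[OF xy this] show "\<exists>g\<in>SO3. y = rot g x" by blast
    qed (use stratum_stable invariants_invariant in auto)
  next
    fix \<Psi> assume sub: "\<Psi> \<subset> {\<kappa>1, \<kappa>2, \<kappa>3}" and basis: "functional_basis ?X \<Psi>"
    then obtain f where f: "f \<in> {\<kappa>1, \<kappa>2, \<kappa>3}" "f \<notin> \<Psi>" by blast
    note det = functional_basis_determines[OF basis invariants_invariant[OF f(1)] E0(1)]
    have agree: "f E0 = f E" if "E \<in> ?X" "\<forall>\<phi>\<in>{\<kappa>1, \<kappa>2, \<kappa>3}. \<phi> \<noteq> f \<longrightarrow> \<phi> E0 = \<phi> E" for E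
    proof (rule det[OF that(1)])
      fix \<phi> assume "\<phi> \<in> \<Psi>"
      then have "\<phi> \<in> {\<kappa>1, \<kappa>2, \<kappa>3}" "\<phi> \<noteq> f" using sub f(2) by auto
      with that(2) show "\<phi> E0 = \<phi> E" by blast
    qed
    from f(1) consider "f = \<kappa>1" | "f = \<kappa>2" | "f = \<kappa>3" by blast
    then show False
    proof cases
      case 1 then show False using agree[OF E1(1)] E0 E1 by simp
    next
      case 2 then show False using agree[OF E2(1)] E0 E2 by simp
    next
      case 3 then show False using agree[OF E3(1)] E0 E3 by simp
    qed
  qed
qed

end
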